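(* Consider four qubits with $\mathbf J=\sum_{i=1}^4\hat\sigma_{i-}$, and $\mathbf H_S=\sum_{\alpha,\beta=1}^4 b_{\alpha\beta}\,\hat\sigma_{\alpha+}\hat\sigma_{\beta-}$, where $(b_{\alpha\beta})$ is a real symmetric $4\times 4$ matrix with equal diagonal entries. Let $$|\mathsf b\rangle=\tfrac1{\sqrt2}(|1000\rangle-|0100\rangle),\quad |\mathsf c\rangle=\tfrac1{\sqrt2}(|0010\rangle-|0001\rangle),\quad |\mathsf i\rangle=\tfrac12(|01\rangle-|10\rangle)(|01\rangle-|10\rangle).$$ (a) If $b_{14}=b_{23}$ and $b_{13}=b_{24}$, then every $|x\rangle\in\mathrm{span}\{|\mathsf b\rangle,|\mathsf c\rangle\}$ satisfies $\mathbf J e^{-i\mathbf H_S t}|x\rangle=0$ for all $t$. (b) If in addition $b_{23}=b_{24}$, then each of the three states $|x\rangle=|\mathsf b\rangle,|\mathsf c\rangle,|\mathsf i\rangle$ satisfies $\mathbf J e^{-i\mathbf H_S t}|x\rangle=0$ for all $t$.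
   Context: Each qubit $\mathbb C^2$ has orthonormal basis $|0\rangle$ (ground), $|1\rangle$ (excited); $|abcd\rangle$ means qubits $1,2,3,4$ are in states $a,b,c,d$ respectively. $\hat\sigma_-=|0\rangle\langle 1|$, $\hat\sigma_+=|1\rangle\langle 0|$, and $\hat\sigma_{i\pm}$ acts as $\hat\sigma_\pm$ on the $i$-th qubit and as the identity on the others. *)

theory Defs
  imports "HOL-Analysis.Analysis"
begin

(* A register of qubits with index type 'q has the configurations 'q => 2 as its
   computational basis, so the states of 'q many qubits form complex ^ ('q => 2).
   The bit type 2 is used with its elements 0 (ground) and 1 (excited).  The four qubits
   are indexed by the type 4 = {1, 2, 3, 4}; in that type the numeral 4 is the same
   element as 0, and likewise 2 = 0 in the index type 2 = {1, 2} of a two-qubit register. *)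

type_synonym 'q config = "'q \<Rightarrow> 2"
type_synonym 'q state = "complex ^ ('q config)"
type_synonym 'q operator = "complex ^ ('q config) ^ ('q config)"

definition bits2 :: "2 \<Rightarrow> 2 \<Rightarrow> 2 config" where
  "bits2 a b = (\<lambda>q. if q = 1 then a else b)"

definition bits4 :: "2 \<Rightarrow> 2 \<Rightarrow> 2 \<Rightarrow> 2 \<Rightarrow> 4 config" where
  "bits4 a b c d = (\<lambda>q. if q = 1 then a else if q = 2 then b else if q = 3 then c else d)"

definition ket2 :: "2 \<Rightarrow> 2 \<Rightarrow> 2 state" where
  "ket2 a b = axis (bits2 a b) 1"

definition ket4 :: "2 \<Rightarrow> 2 \<Rightarrow> 2 \<Rightarrow> 2 \<Rightarrow> 4 state" where
  "ket4 a b c d = axis (bits4 a b c d) 1"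

(* The first factor lives on the qubits 1, 2 and the second one on the qubits 3, 4. *)
definition tensor22 :: "2 state \<Rightarrow> 2 state \<Rightarrow> 4 state" where
  "tensor22 \<phi> \<psi> = (\<chi> x. \<phi> $ bits2 (x 1) (x 2) * \<psi> $ bits2 (x 3) (x 4))"

definition ketbra :: "complex ^ 'm \<Rightarrow> complex ^ 'n \<Rightarrow> complex ^ 'n ^ 'm" where
  "ketbra u v = (\<chi> i j. u $ i * cnj (v $ j))"

definition sigma_minus :: "complex ^ 2 ^ 2" where
  "sigma_minus = ketbra (axis 0 1) (axis 1 1)"

definition sigma_plus :: "complex ^ 2 ^ 2" where
  "sigma_plus = ketbra (axis 1 1) (axis 0 1)"

(* The matrix of A on qubit i tensored with the identity on all other qubits. *)
definition on_qubit :: "'q::finite \<Rightarrow> complex ^ 2 ^ 2 \<Rightarrow> 'q operator" where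
  "on_qubit i A = (\<chi> x y. if \<forall>j. j \<noteq> i \<longrightarrow> x j = y j then A $ x i $ y i else 0)"

definition J_op :: "4 operator" where
  "J_op = (\<Sum>i\<in>UNIV. on_qubit i sigma_minus)"

definition H_S :: "real ^ 4 ^ 4 \<Rightarrow> 4 operator" where
  "H_S b = (\<Sum>\<alpha>\<in>UNIV. \<Sum>\<beta>\<in>UNIV.
     (b $ \<alpha> $ \<beta>) *\<^sub>R (on_qubit \<alpha> sigma_plus ** on_qubit \<beta> sigma_minus))"

(* The type class exponential exp is unavailable here: products on the type vec are
   componentwise, so matrices are not an algebra in the sense of the type classes. *)
primrec matrix_pow :: "complex ^ 'n ^ 'n \<Rightarrow> nat \<Rightarrow> complex ^ 'n ^ 'n" where
  "matrix_pow A 0 = mat 1"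
| "matrix_pow A (Suc k) = A ** matrix_pow A k"

definition matrix_exp :: "complex ^ 'n ^ 'n \<Rightarrow> complex ^ 'n ^ 'n" where
  "matrix_exp A = (\<Sum>k. (1 / fact k) *\<^sub>R matrix_pow A k)"

lemma norm_matrix_pow_entry_le:
  fixes A :: "complex ^ 'n ^ 'n"
  shows "norm (matrix_pow A k $ i $ j) \<le> (\<Sum>i\<in>UNIV. \<Sum>j\<in>UNIV. norm (A $ i $ j)) ^ k"
proof (induction k arbitrary: i j)
  case 0
  show ?case by (simp add: mat_def)
next
  case (Suc k)
  define K where "K = (\<Sum>i\<in>UNIV. \<Sum>j\<in>UNIV. norm (A $ i $ j))"
  have K0: "0 \<le> K" by (simp add: K_def sum_nonneg)
  have row: "(\<Sum>l\<in>UNIV. norm (A $ i $ l)) \<le> K"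
    unfolding K_def by (rule member_le_sum) (auto simp: sum_nonneg)
  have "norm (matrix_pow A (Suc k) $ i $ j)
      \<le> (\<Sum>l\<in>UNIV. norm (A $ i $ l) * norm (matrix_pow A k $ l $ j))"
    by (simp add: matrix_matrix_mult_def flip: norm_mult) (rule norm_sum)
  also have "\<dots> \<le> (\<Sum>l\<in>UNIV. norm (A $ i $ l) * K ^ k)"
    using Suc.IH by (intro sum_mono mult_left_mono) (auto simp: K_def)
  also have "\<dots> = (\<Sum>l\<in>UNIV. norm (A $ i $ l)) * K ^ k"
    by (simp add: sum_distrib_right)
  also have "\<dots> \<le> K * K ^ k"
    using row K0 by (intro mult_right_mono) auto
  finally show ?case by (simp add: K_def)
qed

lemma summable_matrix_exp:
  fixes A :: "complex ^ 'n ^ 'n"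
  shows "summable (\<lambda>k. (1 / fact k) *\<^sub>R matrix_pow A k)"
proof -
  define K where "K = (\<Sum>i\<in>UNIV. \<Sum>j\<in>UNIV. norm (A $ i $ j))"
  define N where "N = (\<Sum>i\<in>(UNIV::'n set). \<Sum>j\<in>(UNIV::'n set). 1 :: real)"
  have le: "norm (matrix_pow A k) \<le> N * K ^ k" for k
  proof -
    have "norm (matrix_pow A k) \<le> (\<Sum>i\<in>UNIV. norm (matrix_pow A k $ i))"
      unfolding norm_vec_def by (rule L2_set_le_sum) simp
    also have "\<dots> \<le> (\<Sum>i\<in>UNIV. \<Sum>j\<in>UNIV. norm (matrix_pow A k $ i $ j))"
      by (intro sum_mono) (subst norm_vec_def, rule L2_set_le_sum, simp)
    also have "\<dots> \<le> (\<Sum>i\<in>(UNIV::'n set). \<Sum>j\<in>(UNIV::'n set). K ^ k)"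
      unfolding K_def by (intro sum_mono norm_matrix_pow_entry_le)
    finally show ?thesis by (simp add: N_def)
  qed
  have "summable (\<lambda>k. N * (inverse (fact k) * K ^ k))"
    by (intro summable_mult summable_exp)
  then show ?thesis
  proof (rule summable_comparison_test')
    fix k :: nat
    show "norm ((1 / fact k) *\<^sub>R matrix_pow A k) \<le> N * (inverse (fact k) * K ^ k)"
      using mult_left_mono[OF le[of k], of "inverse (fact k)"]
      by (simp add: field_simps)
  qed
qed

definition evolution :: "'q::finite operator \<Rightarrow> real \<Rightarrow> 'q operator" where
  "evolution H t = matrix_exp (\<chi> x y. - \<i> * complex_of_real t * H $ x $ y)"

definition state_b :: "4 state" where
  "state_b = (1 / sqrt 2) *\<^sub>R (ket4 1 0 0 0 - ket4 0 1 0 0)"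

definition state_c :: "4 state" where
  "state_c = (1 / sqrt 2) *\<^sub>R (ket4 0 0 1 0 - ket4 0 0 0 1)"

definition state_i :: "4 state" where
  "state_i = (1 / 2) *\<^sub>R tensor22 (ket2 0 1 - ket2 1 0) (ket2 0 1 - ket2 1 0)"

end

(* Under the stated symmetries of b (for span {i}, those of part (b)), span {b, c} and
   span {i} are invariant under H_S, and J kills both.  Hence J kills every term of the
   exponential series applied to a vector of either subspace. *)
theory Submission
  imports Defs
begin

lemma scaleR_matrix_vector_mult:
  fixes A :: "'a::real_algebra_1 ^ 'n ^ 'm"
  shows "(r *\<^sub>R A) *v x = r *\<^sub>R (A *v x)"
  by (simp add: vec_eq_iff matrix_vector_mult_def scaleR_right.sum)

lemma matrix_vector_mult_scaleR_right:
  fixes A :: "'a::real_algebra_1 ^ 'n ^ 'm"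
  shows "A *v (r *\<^sub>R x) = r *\<^sub>R (A *v x)"
  by (simp add: vec_eq_iff matrix_vector_mult_def scaleR_right.sum)

text \<open>Linearity of \<open>A\<close> carries invariance from the generators to their complex
  span, and this is then iterated over the powers.\<close>

lemma matrix_pow_in_span:
  assumes inv: "\<And>g. g \<in> G \<Longrightarrow> A *v g \<in> vec.span G"
    and x: "x \<in> vec.span G"
  shows "matrix_pow A k *v x \<in> vec.span G"
proof (induction k)
  case 0
  show ?case using x by simp
next
  case (Suc k)
  have "A *v y \<in> vec.span G" if "y \<in> vec.span G" for y
    using that
    by (induction rule: vec.span_induct_alt)
      (auto simp: vec.add vec.scale intro!: vec.span_zero vec.span_add vec.span_scale inv)
  from this[OF Suc.IH] show ?case
    by (simp flip: matrix_vector_mul_assoc)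
qed

lemma matrix_exp_annihilated:
  assumes inv: "\<And>g. g \<in> G \<Longrightarrow> A *v g \<in> vec.span G"
    and ann: "\<And>g. g \<in> G \<Longrightarrow> B *v g = 0"
    and x: "x \<in> vec.span G"
  shows "B *v (matrix_exp A *v x) = 0"
proof -
  have zero: "B *v y = 0" if "y \<in> vec.span G" for y
    using that by (induction rule: vec.span_induct_alt) (simp_all add: vec.add vec.scale ann)
  \<comment> \<open>For fixed \<open>B\<close> and \<open>x\<close> this is linear in the matrix
    \<open>M\<close>; in finite dimension it is therefore bounded and may be pulled through the
    convergent exponential series.\<close>
  define L where "L M = B *v (M *v x)" for M
  have "linear L"
    by (rule linearI) (simp_all add: L_def matrix_vector_mult_add_rdistrib vec.add
      scaleR_matrix_vector_mult matrix_vector_mult_scaleR_right)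
  then have "L (matrix_exp A) = (\<Sum>k. L ((1 / fact k) *\<^sub>R matrix_pow A k))"
    unfolding matrix_exp_def
    by (intro bounded_linear.suminf linear_conv_bounded_linear[THEN iffD1] summable_matrix_exp)
  moreover have "L ((1 / fact k) *\<^sub>R matrix_pow A k) = 0" for k
    using zero[OF matrix_pow_in_span[OF inv x]]
    by (simp add: L_def scaleR_matrix_vector_mult matrix_vector_mult_scaleR_right)
  ultimately show ?thesis by (simp add: L_def)
qed

text \<open>The exponent is \<open>H\<close> times the scalar -i t, and \<open>vec.span\<close> is
  closed under complex scalars, so invariance is checked for \<open>H\<close> alone.\<close>

lemma evolution_annihilated:
  assumes inv: "\<And>g. g \<in> G \<Longrightarrow> H *v g \<in> vec.span G"
    and ann: "\<And>g. g \<in> G \<Longrightarrow> B *v g = 0"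
    and x: "x \<in> vec.span G"
  shows "B *v (evolution H t *v x) = 0"
  unfolding evolution_def
proof (rule matrix_exp_annihilated[OF _ ann x])
  fix g assume "g \<in> G"
  have "(\<chi> x y. - \<i> * complex_of_real t * H $ x $ y) *v g = (- \<i> * complex_of_real t) *s (H *v g)"
    by (simp add: vec_eq_iff matrix_vector_mult_def sum_distrib_left mult.assoc sum_negf)
  then show "(\<chi> x y. - \<i> * complex_of_real t * H $ x $ y) *v g \<in> vec.span G"
    by (simp only: vec.span_scale[OF inv[OF \<open>g \<in> G\<close>]])
qed

text \<open>Bridges the real scaling in \<open>H_S\<close> and the states to the complex scaling
  \<open>*s\<close> of \<open>vec.span\<close>.\<close>

lemma scaleR_in_vec_span:
  fixes x :: "complex ^ 'n"
  assumes "x \<in> vec.span G"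
  shows "r *\<^sub>R x \<in> vec.span G"
proof -
  have "r *\<^sub>R x = complex_of_real r *s x"
    by (simp only: vec_eq_iff vector_scaleR_component vector_smult_component) (simp add: scaleR_conv_of_real)
  then show ?thesis by (simp add: vec.span_scale assms)
qed

lemma on_qubit_axis:
  "on_qubit i A *v axis x 1 = (\<chi> y. if \<forall>j. j \<noteq> i \<longrightarrow> y j = x j then A $ y i $ x i else 0)"
  by (simp add: vec_eq_iff on_qubit_def matrix_vector_mult_def axis_def mult_delta_right)

text \<open>Fuses the agreement off \<open>i\<close> demanded by \<open>on_qubit\<close> with the
  value at \<open>i\<close> into one equality, so that a column of the operator is recognised as a
  basis vector.\<close>

lemma config_eq_upd_iff: "y = x(i := a) \<longleftrightarrow> (\<forall>j. j \<noteq> i \<longrightarrow> y j = x j) \<and> y i = a"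
  by (auto simp: fun_eq_iff)

lemma on_qubit_sigma_minus_axis:
  "on_qubit i sigma_minus *v axis x 1 = (if x i = 1 then axis (x(i := 0)) 1 else 0)"
  unfolding on_qubit_axis by (auto simp: vec_eq_iff sigma_minus_def ketbra_def axis_def config_eq_upd_iff)

lemma on_qubit_sigma_plus_axis:
  "on_qubit i sigma_plus *v axis x 1 = (if x i = 0 then axis (x(i := 1)) 1 else 0)"
  unfolding on_qubit_axis by (auto simp: vec_eq_iff sigma_plus_def ketbra_def axis_def config_eq_upd_iff)

lemma bits4_upd:
  "(bits4 a b c d)(1 := e) = bits4 e b c d"
  "(bits4 a b c d)(2 := e) = bits4 a e c d"
  "(bits4 a b c d)(3 := e) = bits4 a b e d"
  "(bits4 a b c d)(4 := e) = bits4 a b c e"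
  unfolding fun_eq_iff forall_4 by (simp_all add: bits4_def)

lemma bits4_apply:
  "bits4 a b c d 1 = a" "bits4 a b c d 2 = b" "bits4 a b c d 3 = c" "bits4 a b c d 4 = d"
  by (simp_all add: bits4_def)

lemma sigma_minus_ket4:
  "on_qubit 1 sigma_minus *v ket4 a b c d = (if a = 1 then ket4 0 b c d else 0)"
  "on_qubit 2 sigma_minus *v ket4 a b c d = (if b = 1 then ket4 a 0 c d else 0)"
  "on_qubit 3 sigma_minus *v ket4 a b c d = (if c = 1 then ket4 a b 0 d else 0)"
  "on_qubit 4 sigma_minus *v ket4 a b c d = (if d = 1 then ket4 a b c 0 else 0)"
  by (simp_all only: ket4_def on_qubit_sigma_minus_axis bits4_apply bits4_upd)

lemma sigma_plus_ket4:
  "on_qubit 1 sigma_plus *v ket4 a b c d = (if a = 0 then ket4 1 b c d else 0)"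
  "on_qubit 2 sigma_plus *v ket4 a b c d = (if b = 0 then ket4 a 1 c d else 0)"
  "on_qubit 3 sigma_plus *v ket4 a b c d = (if c = 0 then ket4 a b 1 d else 0)"
  "on_qubit 4 sigma_plus *v ket4 a b c d = (if d = 0 then ket4 a b c 1 else 0)"
  by (simp_all only: ket4_def on_qubit_sigma_plus_axis bits4_apply bits4_upd)

text \<open>Kets are indicator functions, and a four-qubit configuration is determined by its two
  halves.\<close>

lemma tensor22_ket2: "tensor22 (ket2 a b) (ket2 c d) = ket4 a b c d"
proof -
  have "bits2 p q = bits2 a b \<longleftrightarrow> p = a \<and> q = b" for p q a b
    by (simp add: fun_eq_iff forall_2 bits2_def)
  moreover have "x = bits4 a b c d \<longleftrightarrow> x 1 = a \<and> x 2 = b \<and> x 3 = c \<and> x 4 = d" for x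
    by (simp only: fun_eq_iff forall_4 bits4_apply)
  ultimately show ?thesis
    by (simp add: vec_eq_iff tensor22_def ket2_def ket4_def axis_def)
qed

lemma state_i_ket4:
  "state_i = (1 / 2) *\<^sub>R (ket4 0 1 0 1 - ket4 0 1 1 0 - ket4 1 0 0 1 + ket4 1 0 1 0)"
proof -
  have "tensor22 (\<phi> - \<phi>') (\<psi> - \<psi>')
      = tensor22 \<phi> \<psi> - tensor22 \<phi> \<psi>' - tensor22 \<phi>' \<psi> + tensor22 \<phi>' \<psi>'" for \<phi> \<phi>' \<psi> \<psi>'
    by (simp add: vec_eq_iff tensor22_def algebra_simps)
  then show ?thesis by (simp add: state_i_def tensor22_ket2)
qed

lemma J_op_mult: "J_op *v x = (\<Sum>i\<in>UNIV. on_qubit i sigma_minus *v x)"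
  unfolding J_op_def sum_4 by (simp add: matrix_vector_mult_add_rdistrib)

text \<open>Letting the factors act one after the other replaces matrix products by the ket
  rules.\<close>

lemma H_S_mult:
  "H_S b *v x = (\<Sum>\<alpha>\<in>UNIV. \<Sum>\<beta>\<in>UNIV.
     b $ \<alpha> $ \<beta> *\<^sub>R (on_qubit \<alpha> sigma_plus *v (on_qubit \<beta> sigma_minus *v x)))"
  unfolding H_S_def sum_4
  by (simp add: matrix_vector_mult_add_rdistrib matrix_vector_mul_assoc scaleR_matrix_vector_mult)

text \<open>Each state is antisymmetric within the pairs {1,2} and {3,4} that carry an excitation,
  so the two lowerings inside such a pair cancel.\<close>

lemma J_op_states: "J_op *v state_b = 0" "J_op *v state_c = 0" "J_op *v state_i = 0"
  by (simp_all add: J_op_mult sum_4 state_b_def state_c_def state_i_ket4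
      matrix_vector_mult_scaleR_right vec.add vec.diff sigma_minus_ket4)

text \<open>On one excitation \<open>H_S b\<close> acts as the matrix \<open>b\<close> on
  amplitudes, here (1,-1,0,0) up to normalisation. The hypotheses make the image antisymmetric
  within both pairs.\<close>

lemma H_S_state_b:
  assumes "b $ 2 $ 1 = b $ 1 $ 2" and "b $ 2 $ 2 = b $ 1 $ 1"
    and "b $ 4 $ 1 = b $ 3 $ 2" "b $ 3 $ 1 = b $ 4 $ 2"
  shows "H_S b *v state_b
    = (b $ 1 $ 1 - b $ 1 $ 2) *\<^sub>R state_b + (b $ 4 $ 2 - b $ 3 $ 2) *\<^sub>R state_c"
  by (simp add: H_S_mult sum_4 state_b_def state_c_def matrix_vector_mult_scaleR_right vec.diff
      sigma_minus_ket4 sigma_plus_ket4 assms algebra_simps)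

text \<open>The mirror image, with the pairs {1,2} and {3,4} exchanged.\<close>

lemma H_S_state_c:
  assumes "b $ 4 $ 3 = b $ 3 $ 4" and "b $ 4 $ 4 = b $ 3 $ 3"
    and "b $ 1 $ 4 = b $ 2 $ 3" "b $ 1 $ 3 = b $ 2 $ 4"
  shows "H_S b *v state_c
    = (b $ 2 $ 4 - b $ 2 $ 3) *\<^sub>R state_b + (b $ 3 $ 3 - b $ 3 $ 4) *\<^sub>R state_c"
  by (simp add: H_S_mult sum_4 state_b_def state_c_def matrix_vector_mult_scaleR_right vec.diff
      sigma_minus_ket4 sigma_plus_ket4 assms algebra_simps)

text \<open>With a common coupling \<open>g\<close>, hopping between the pairs contains the total
  lowering of one pair, which kills its singlet. The two excitations give the diagonal term twice,
  and exchange within a pair flips the sign of its singlet.\<close>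

lemma H_S_state_i:
  assumes "b $ 2 $ 1 = b $ 1 $ 2" "b $ 4 $ 3 = b $ 3 $ 4"
    and "b $ 2 $ 2 = b $ 1 $ 1" "b $ 3 $ 3 = b $ 1 $ 1" "b $ 4 $ 4 = b $ 1 $ 1"
    and "b $ 1 $ 3 = g" "b $ 1 $ 4 = g" "b $ 2 $ 3 = g" "b $ 2 $ 4 = g"
    and "b $ 3 $ 1 = g" "b $ 4 $ 1 = g" "b $ 3 $ 2 = g" "b $ 4 $ 2 = g"
  shows "H_S b *v state_i = (2 * b $ 1 $ 1 - b $ 1 $ 2 - b $ 3 $ 4) *\<^sub>R state_i"
proof -
  define v :: "4 state" where "v = ket4 0 1 0 1 - ket4 0 1 1 0 - ket4 1 0 0 1 + ket4 1 0 1 0"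
  have "H_S b *v v = (2 * b $ 1 $ 1 - b $ 1 $ 2 - b $ 3 $ 4) *\<^sub>R v"
    by (simp add: v_def H_S_mult sum_4 vec.diff vec.add sigma_minus_ket4 sigma_plus_ket4
        assms, simp add: vec_eq_iff scaleR_conv_of_real algebra_simps)
  then show ?thesis
    by (simp add: state_i_ket4 matrix_vector_mult_scaleR_right flip: v_def)
qed

theorem mainTheorem4:
  fixes b :: "real ^ 4 ^ 4"
  assumes symmetric: "transpose b = b"
    and equal_diagonal: "\<And>\<alpha> \<beta>. b $ \<alpha> $ \<alpha> = b $ \<beta> $ \<beta>"
  shows "(b $ 1 $ 4 = b $ 2 $ 3 \<and> b $ 1 $ 3 = b $ 2 $ 4 \<longrightarrow>
           (\<forall>x \<in> vec.span {state_b, state_c}. \<forall>t :: real.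
              J_op *v (evolution (H_S b) t *v x) = 0)) \<and>
         (b $ 1 $ 4 = b $ 2 $ 3 \<and> b $ 1 $ 3 = b $ 2 $ 4 \<and> b $ 2 $ 3 = b $ 2 $ 4 \<longrightarrow>
           (\<forall>x \<in> {state_b, state_c, state_i}. \<forall>t :: real.
              J_op *v (evolution (H_S b) t *v x) = 0))"
proof -
  have sym: "b $ \<alpha> $ \<beta> = b $ \<beta> $ \<alpha>" for \<alpha> \<beta>
    using arg_cong[OF symmetric, of "\<lambda>m. m $ \<alpha> $ \<beta>"] by (simp add: transpose_def)
  have part_a: "J_op *v (evolution (H_S b) t *v x) = 0"
    if b: "b $ 1 $ 4 = b $ 2 $ 3" "b $ 1 $ 3 = b $ 2 $ 4"
      and x: "x \<in> vec.span {state_b, state_c}" for x t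
  proof -
    \<comment> \<open>Symmetry turns the hypotheses \<open>b\<close> into the transposed equations
      required here.\<close>
    have "H_S b *v state_b \<in> vec.span {state_b, state_c}"
      using H_S_state_b[of b] sym equal_diagonal b
      by (metis insertI1 insertI2 scaleR_in_vec_span vec.span_add vec.span_base)
    moreover have "H_S b *v state_c \<in> vec.span {state_b, state_c}"
      using H_S_state_c[of b] sym equal_diagonal b
      by (metis insertI1 insertI2 scaleR_in_vec_span vec.span_add vec.span_base)
    ultimately show ?thesis
      by (intro evolution_annihilated[OF _ _ x]) (auto simp: J_op_states)
  qed
  have part_b: "J_op *v (evolution (H_S b) t *v state_i) = 0"
    if b: "b $ 1 $ 4 = b $ 2 $ 3" "b $ 1 $ 3 = b $ 2 $ 4" "b $ 2 $ 3 = b $ 2 $ 4" for t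
  proof -
    have "H_S b *v state_i \<in> vec.span {state_i}"
      \<comment> \<open>The three equations make all four couplings between the pairs equal to
        \<open>b $ 2 $ 4\<close>, which serves as \<open>g\<close>.\<close>
      using H_S_state_i[of b "b $ 2 $ 4"] sym equal_diagonal b
      by (metis insertI1 scaleR_in_vec_span vec.span_base)
    then show ?thesis
      by (intro evolution_annihilated[of "{state_i}"]) (auto simp: J_op_states intro: vec.span_base)
  qed
  \<comment> \<open>In the second claim, \<open>state_b\<close> and \<open>state_c\<close> are
    covered by \<open>part_a\<close> as generators of the span.\<close>
  show ?thesis
    using part_a part_b by (auto intro: vec.span_base)
qed

end
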